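(* Let $K,T\subset\mathbb{R}^n$ be strictly convex and smooth convex bodies. Let $q=(q_1,\dots,q_m)$ be an $\ell_T$-minimizing closed $(K,T)$-Minkowski billiard trajectory and let $V$ be an affine subspace of $\mathbb{R}^n$ such that $K\cap V$ is the inclusion-minimal affine section of $K$ containing $q$. Then $\dim V=m-1$, i.e., the convex hull of $q_1,\dots,q_m$ has dimension $m-1$.
   Context: A convex body in $\mathbb{R}^n$ is a compact convex set containing the origin in its interior; it is smooth if through each boundary point there is a unique supporting hyperplane. For a convex body $T$, $T^\circ$ is its polar body and $\mu_{T^\circ}(x)=\min\{t\ge 0: x\in tT^\circ\}$. For a convex set $C$ and $z\in\partial C$, $N_C(z)=\{v:\langle v,y-z\rangle\le 0\ \forall y\in C\}$. A closed polygonal curve $(q_1,\dots,q_m)$, $m\ge2$, always satisfies $q_j\ne q_{j+1}$ and $q_j\notin[q_{j-1},q_{j+1}]$ (indices mod $m$); $\ell_T(q)=\sum_j\mu_{T^\circ}(q_{j+1}-q_j)$. A closed polygonal curve $q$ with vertices on $\partial K$ is a closed $(K,T)$-Minkowski billiard trajectory if there are $p_1,\dots,p_m\in\partial T$ with $q_{j+1}-q_j\in N_T(p_j)$ and $p_{j+1}-p_j\in -N_K(q_{j+1})$ for all $j$. It is $\ell_T$-minimizing if its $\ell_T$-length is minimal among all closed $(K,T)$-Minkowski billiard trajectories. An affine section of $K$ is a set $K\cap V$ with $V$ an affine subspace. *)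

theory Defs
  imports "HOL-Analysis.Analysis"
begin

definition convex_body :: "'a::euclidean_space set \<Rightarrow> bool" where
  "convex_body K \<longleftrightarrow> compact K \<and> convex K \<and> 0 \<in> interior K"

text \<open>Strictly convex: open segments between distinct points lie in the interior
  (equivalently, the boundary contains no nondegenerate segment).\<close>
definition strictly_convex :: "'a::euclidean_space set \<Rightarrow> bool" where
  "strictly_convex K \<longleftrightarrow>
     (\<forall>x\<in>K. \<forall>y\<in>K. x \<noteq> y \<longrightarrow> open_segment x y \<subseteq> interior K)"

definition supporting_hyperplane :: "'a::euclidean_space set \<Rightarrow> 'a \<Rightarrow> 'a set \<Rightarrow> bool" where
  "supporting_hyperplane K z H \<longleftrightarrow>
     (\<exists>u. u \<noteq> 0 \<and> H = {x. u \<bullet> x = u \<bullet> z} \<and> (\<forall>y\<in>K. u \<bullet> y \<le> u \<bullet> z))"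

definition smooth_body :: "'a::euclidean_space set \<Rightarrow> bool" where
  "smooth_body K \<longleftrightarrow> (\<forall>z\<in>frontier K. \<exists>!H. supporting_hyperplane K z H)"

definition polar :: "'a::euclidean_space set \<Rightarrow> 'a set" where
  "polar T = {y. \<forall>x\<in>T. x \<bullet> y \<le> 1}"

definition gauge :: "'a::euclidean_space set \<Rightarrow> 'a \<Rightarrow> real" where
  "gauge C x = Inf {t::real. t \<ge> 0 \<and> x \<in> (\<lambda>y. t *\<^sub>R y) ` C}"

definition normal_cone :: "'a::euclidean_space set \<Rightarrow> 'a \<Rightarrow> 'a set" where
  "normal_cone C z = {v. \<forall>y\<in>C. v \<bullet> (y - z) \<le> 0}"

definition closed_polygonal :: "nat \<Rightarrow> (nat \<Rightarrow> 'a::euclidean_space) \<Rightarrow> bool" where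
  "closed_polygonal m q \<longleftrightarrow> m \<ge> 2 \<and>
     (\<forall>j<m. q j \<noteq> q (Suc j mod m) \<and>
            q j \<notin> closed_segment (q ((j + m - 1) mod m)) (q (Suc j mod m)))"

definition ell :: "'a::euclidean_space set \<Rightarrow> nat \<Rightarrow> (nat \<Rightarrow> 'a) \<Rightarrow> real" where
  "ell T m q = (\<Sum>j<m. gauge (polar T) (q (Suc j mod m) - q j))"

definition minkowski_billiard :: "'a::euclidean_space set \<Rightarrow> 'a set \<Rightarrow> nat \<Rightarrow> (nat \<Rightarrow> 'a) \<Rightarrow> bool" where
  "minkowski_billiard K T m q \<longleftrightarrow> closed_polygonal m q \<and> (\<forall>j<m. q j \<in> frontier K) \<and>
     (\<exists>p. \<forall>j<m. p j \<in> frontier T \<and>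
            q (Suc j mod m) - q j \<in> normal_cone T (p j) \<and>
            p (Suc j mod m) - p j \<in> uminus ` normal_cone K (q (Suc j mod m)))"

definition ell_minimizing :: "'a::euclidean_space set \<Rightarrow> 'a set \<Rightarrow> nat \<Rightarrow> (nat \<Rightarrow> 'a) \<Rightarrow> bool" where
  "ell_minimizing K T m q \<longleftrightarrow> minkowski_billiard K T m q \<and>
     (\<forall>m' q'. minkowski_billiard K T m' q' \<longrightarrow> ell T m q \<le> ell T m' q')"

end

theory Submission
  imports Defs
begin

text \<open>For closed polygons \<open>q\<close>, \<open>p\<close> with \<open>m\<close> vertices, the action
  \<open>A(q, p) = \<Sum>\<^sub>j \<langle>p\<^sub>j, q\<^sub>j\<^sub>+\<^sub>1 - q\<^sub>j\<rangle> = \<Sum>\<^sub>j \<langle>q\<^sub>j\<^sub>+\<^sub>1, p\<^sub>j - p\<^sub>j\<^sub>+\<^sub>1\<rangle>\<close> is invariant under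
  translation of either polygon. Maximising \<open>A(q, p)\<close> relative to \<open>\<ell>\<^sub>T(q) \<ell>\<^sub>K(-p)\<close> is a compact problem,
  and by convex duality a maximising pair is, up to translation, scaling and removal of degenerate
  vertices, a billiard trajectory with its dual. Hence a shortest trajectory \<open>q\<close> with dual \<open>p\<close> is
  itself a maximising pair. If \<open>q\<close> were affinely dependent, its edges \<open>e\<^sub>j\<close> would satisfy a second
  linear relation, and there would be a closed polygon, not homothetic to \<open>q\<close>, whose edges are
  positive multiples of the \<open>e\<^sub>j\<close>. Paired with \<open>p\<close> it would be maximising too, so a homothetic copy
  of it would have vertices in \<open>K\<close> with outer normals \<open>p\<^sub>j - p\<^sub>j\<^sub>+\<^sub>1 \<noteq> 0\<close>. By strict convexity of \<open>K\<close>
  these vertices are those of \<open>q\<close>, a contradiction.\<close>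

section \<open>Support functions and normal cones\<close>

lemma convex_bodyD:
  assumes "convex_body C"
  shows "compact C" "convex C" "0 \<in> interior C" "0 \<in> C" "C \<noteq> {}" "closed C"
  using assms interior_subset unfolding convex_body_def by (auto simp: compact_imp_closed)

lemma inner_bdd_above:
  assumes "convex_body C"
  shows "bdd_above ((\<lambda>x. x \<bullet> v) ` C)"
proof -
  have "compact ((\<lambda>x. x \<bullet> v) ` C)"
    by (intro compact_continuous_image convex_bodyD assms continuous_intros)
  then show ?thesis
    by (simp add: bounded_imp_bdd_above compact_imp_bounded)
qed

text \<open>For \<open>t > 0\<close>, \<open>v\<close> lies in \<open>t\<close> times the polar
  exactly when \<open>t\<close> bounds \<open>x \<bullet> v\<close> for all \<open>x\<close> in
  \<open>C\<close>. So the gauge of the polar is the support function of \<open>C\<close>, the form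
  in which lengths are handled below.\<close>

lemma gauge_polar_eq_SUP:
  assumes C: "convex_body C"
  shows "gauge (polar C) v = (SUP x\<in>C. x \<bullet> v)"
proof -
  have ne: "C \<noteq> {}" and "0 \<in> C" using convex_bodyD[OF C] by auto
  have nonneg: "0 \<le> (SUP x\<in>C. x \<bullet> v)"
    using cSUP_upper[OF \<open>0 \<in> C\<close> inner_bdd_above[OF C, of v]] by simp
  have iff: "v \<in> (\<lambda>y. t *\<^sub>R y) ` polar C \<longleftrightarrow> (SUP x\<in>C. x \<bullet> v) \<le> t" if t: "0 \<le> t" for t
  proof (cases "t = 0")
    case True
    \<comment> \<open>The scaled polar is \<open>{0}\<close> here, so the support function must be
      positive at every nonzero \<open>v\<close>; a ball around the origin inside \<open>C\<close>
      ensures this.\<close>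
    obtain r where r: "r > 0" "cball 0 r \<subseteq> C"
      using convex_bodyD(3)[OF C] by (auto simp: mem_interior_cball)
    have "v = 0" if "(SUP x\<in>C. x \<bullet> v) \<le> 0"
    proof (rule ccontr)
      assume "v \<noteq> 0"
      then have "(r / norm v) *\<^sub>R v \<in> C" using r by (intro subsetD[OF r(2)]) simp
      from cSUP_upper[OF this inner_bdd_above[OF C, of v]] that
      have "(r / norm v) * (v \<bullet> v) \<le> 0" by simp
      moreover have "(r / norm v) * (v \<bullet> v) > 0" using r \<open>v \<noteq> 0\<close> by simp
      ultimately show False by simp
    qed
    moreover have "0 \<in> polar C" by (simp add: polar_def)
    moreover have "(SUP x\<in>C. x \<bullet> 0) \<le> 0" using ne by simp
    ultimately show ?thesis using True by auto
  next
    case False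
    with t have t: "t > 0" by simp
    have "v \<in> (\<lambda>y. t *\<^sub>R y) ` polar C \<longleftrightarrow> v /\<^sub>R t \<in> polar C"
      using t by (force simp: image_iff)
    also have "\<dots> \<longleftrightarrow> (\<forall>x\<in>C. x \<bullet> v \<le> t)"
      using t by (simp add: polar_def field_simps)
    also have "\<dots> \<longleftrightarrow> (SUP x\<in>C. x \<bullet> v) \<le> t"
      using cSUP_le_iff[OF ne inner_bdd_above[OF C]] by simp
    finally show ?thesis .
  qed
  have "{t. t \<ge> 0 \<and> v \<in> (\<lambda>y. t *\<^sub>R y) ` polar C} = {(SUP x\<in>C. x \<bullet> v)..}"
    using iff nonneg by fastforce
  then show ?thesis by (simp add: gauge_def)
qed

lemma inner_le_gauge_polar:
  assumes "convex_body C" "x \<in> C"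
  shows "x \<bullet> v \<le> gauge (polar C) v"
  using cSUP_upper[OF assms(2) inner_bdd_above[OF assms(1), of v]]
  by (simp add: gauge_polar_eq_SUP[OF assms(1)])

lemma gauge_polar_attained:
  assumes C: "convex_body C"
  obtains x where "x \<in> C" "x \<bullet> v = gauge (polar C) v"
proof -
  have "continuous_on C (\<lambda>x. x \<bullet> v)" by (intro continuous_intros)
  then obtain x where x: "x \<in> C" "\<And>y. y \<in> C \<Longrightarrow> y \<bullet> v \<le> x \<bullet> v"
    using continuous_attains_sup convex_bodyD[OF C] by metis
  have "gauge (polar C) v \<le> x \<bullet> v"
    unfolding gauge_polar_eq_SUP[OF C] by (intro cSUP_least convex_bodyD[OF C] x)
  then show ?thesis using that[OF x(1)] inner_le_gauge_polar[OF C x(1), of v] by simp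
qed

lemma gauge_polar_nonneg: "convex_body C \<Longrightarrow> 0 \<le> gauge (polar C) v"
  using inner_le_gauge_polar[of C 0 v] convex_bodyD(4)[of C] by simp

lemma gauge_polar_scale:
  assumes C: "convex_body C" and "0 \<le> a"
  shows "gauge (polar C) (a *\<^sub>R v) = a * gauge (polar C) v"
proof (rule antisym)
  obtain x where "x \<in> C" "x \<bullet> (a *\<^sub>R v) = gauge (polar C) (a *\<^sub>R v)"
    using gauge_polar_attained[OF C] .
  then show "gauge (polar C) (a *\<^sub>R v) \<le> a * gauge (polar C) v"
    using inner_le_gauge_polar[OF C, of x v] \<open>0 \<le> a\<close> by (metis inner_scaleR_right mult_left_mono)
  obtain x where "x \<in> C" "x \<bullet> v = gauge (polar C) v"
    using gauge_polar_attained[OF C] .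
  then show "a * gauge (polar C) v \<le> gauge (polar C) (a *\<^sub>R v)"
    using inner_le_gauge_polar[OF C, of x "a *\<^sub>R v"] by simp
qed

text \<open>\<open>r\<close> is the radius of a ball around the origin inside \<open>C\<close>. The
  bound later confines polygons of bounded length, up to translation.\<close>

lemma gauge_polar_lower_bound:
  assumes C: "convex_body C"
  obtains r where "r > 0" "\<And>v. r * norm v \<le> gauge (polar C) v"
proof -
  obtain r where r: "r > 0" "cball 0 r \<subseteq> C"
    using convex_bodyD(3)[OF C] by (auto simp: mem_interior_cball)
  have "r * norm v \<le> gauge (polar C) v" for v
  proof (cases "v = 0")
    case False
    then have "(r / norm v) *\<^sub>R v \<in> C" using r by (intro subsetD[OF r(2)]) simp
    from inner_le_gauge_polar[OF C this, of v] False show ?thesis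
      by (simp add: power2_norm_eq_inner[symmetric] power2_eq_square)
  qed (simp add: gauge_polar_nonneg[OF C])
  with r(1) show ?thesis using that by blast
qed

text \<open>A maximiser for \<open>u\<close> also competes for \<open>v\<close>, so a norm bound
  \<open>B\<close> on \<open>C\<close> is a Lipschitz constant.\<close>

lemma gauge_polar_continuous:
  assumes C: "convex_body C"
  shows "continuous_on UNIV (gauge (polar C))"
proof -
  obtain B where B: "\<And>x. x \<in> C \<Longrightarrow> norm x \<le> B"
    using compact_imp_bounded[OF convex_bodyD(1)[OF C]] by (auto simp: bounded_iff)
  have "0 \<le> B" using B[OF convex_bodyD(4)[OF C]] by simp
  have le: "gauge (polar C) u \<le> gauge (polar C) v + B * norm (u - v)" for u v
  proof -
    obtain x where x: "x \<in> C" "x \<bullet> u = gauge (polar C) u"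
      using gauge_polar_attained[OF C] .
    have "x \<bullet> (u - v) \<le> B * norm (u - v)"
      using norm_cauchy_schwarz[of x "u - v"] B[OF x(1)] mult_right_mono[of "norm x" B "norm (u - v)"]
      by simp
    then show ?thesis using x inner_le_gauge_polar[OF C x(1), of v] by (simp add: inner_diff_right)
  qed
  have "B-lipschitz_on UNIV (gauge (polar C))"
  proof (rule lipschitz_onI)
    fix u v
    show "dist (gauge (polar C) u) (gauge (polar C) v) \<le> B * dist u v"
      using le[of u v] le[of v u] by (simp add: dist_norm norm_minus_commute abs_le_iff)
  qed (rule \<open>0 \<le> B\<close>)
  then show ?thesis by (rule lipschitz_on_continuous_on)
qed

text \<open>Normality is the equality case of \<open>inner_le_gauge_polar\<close>. Hence a sum of
  such inequalities is tight exactly when all the normality conditions hold.\<close>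

lemma normal_cone_iff_gauge_polar:
  assumes C: "convex_body C" and "z \<in> C"
  shows "v \<in> normal_cone C z \<longleftrightarrow> z \<bullet> v = gauge (polar C) v"
proof
  assume "v \<in> normal_cone C z"
  moreover obtain x where "x \<in> C" "x \<bullet> v = gauge (polar C) v"
    using gauge_polar_attained[OF C] .
  ultimately show "z \<bullet> v = gauge (polar C) v"
    using inner_le_gauge_polar[OF assms, of v]
    by (force simp: normal_cone_def inner_diff_right inner_commute)
next
  assume "z \<bullet> v = gauge (polar C) v"
  then show "v \<in> normal_cone C z"
    using inner_le_gauge_polar[OF C, of _ v]
    by (auto simp: normal_cone_def inner_diff_right inner_commute)
qed

lemma normal_cone_add:
  "u \<in> normal_cone C z \<Longrightarrow> v \<in> normal_cone C z \<Longrightarrow> u + v \<in> normal_cone C z"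
  by (simp add: normal_cone_def inner_add_left add_nonpos_nonpos)

lemma normal_cone_scale:
  "0 \<le> a \<Longrightarrow> v \<in> normal_cone C z \<Longrightarrow> a *\<^sub>R v \<in> normal_cone C z"
  by (simp add: normal_cone_def mult_nonneg_nonpos)

lemma normal_cone_frontier:
  assumes "z \<in> C" "v \<in> normal_cone C z" "v \<noteq> 0"
  shows "z \<in> frontier C"
proof -
  have "z \<notin> interior C"
  proof
    assume "z \<in> interior C"
    then obtain r where r: "r > 0" "cball z r \<subseteq> C" by (auto simp: mem_interior_cball)
    have "z + (r / norm v) *\<^sub>R v \<in> C" using r assms(3) by (intro subsetD[OF r(2)]) (simp add: dist_norm)
    then have "(r / norm v) * (v \<bullet> v) \<le> 0" using assms(2) by (force simp: normal_cone_def)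
    moreover have "(r / norm v) * (v \<bullet> v) > 0" using r assms(3) by simp
    ultimately show False by simp
  qed
  then show ?thesis using assms(1) closure_subset by (auto simp: frontier_def)
qed

text \<open>Otherwise the midpoint of \<open>y\<close> and \<open>z\<close> would be an interior
  point with the nonzero normal \<open>v\<close>.\<close>

lemma strictly_convex_normal_unique:
  assumes "strictly_convex C" "y \<in> C" "z \<in> C" "v \<in> normal_cone C y" "v \<in> normal_cone C z" "v \<noteq> 0"
  shows "y = z"
proof (rule ccontr)
  assume "y \<noteq> z"
  define w where "w = (1/2) *\<^sub>R y + (1/2) *\<^sub>R z"
  have "w \<in> open_segment y z"
    using \<open>y \<noteq> z\<close> unfolding w_def in_segment by (intro conjI exI[of _ "1/2"]) auto
  then have int: "w \<in> interior C" using assms(1-3) \<open>y \<noteq> z\<close> by (auto simp: strictly_convex_def)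
  have "v \<bullet> (y - z) \<le> 0" "v \<bullet> (z - y) \<le> 0"
    using assms by (auto simp: normal_cone_def)
  then have "v \<bullet> y = v \<bullet> z" by (simp add: inner_diff_right)
  then have "v \<bullet> w = v \<bullet> z" by (simp add: w_def inner_add_right)
  then have "v \<in> normal_cone C w" using assms(5) by (simp add: normal_cone_def inner_diff_right)
  then show False
    using normal_cone_frontier[of w C v] int interior_subset assms(6) by (auto simp: frontier_def)
qed

text \<open>Uniqueness of the supporting hyperplane makes \<open>u\<close> and \<open>v\<close>
  parallel. Since the origin is interior, both have positive inner product with \<open>z\<close>,
  which fixes the sign of the factor.\<close>

lemma smooth_normal_proportional:
  assumes "smooth_body C" "z \<in> frontier C" and u: "u \<in> normal_cone C z" "u \<noteq> 0"
    and v: "v \<in> normal_cone C z" "v \<noteq> 0" and "0 \<in> interior C"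
  obtains a where "a > 0" "v = a *\<^sub>R u"
proof -
  have sup: "supporting_hyperplane C z {x. w \<bullet> x = w \<bullet> z}" if "w \<in> normal_cone C z" "w \<noteq> 0" for w
    using that by (auto simp: supporting_hyperplane_def normal_cone_def inner_diff_right)
  have pos: "w \<bullet> z > 0" if "w \<in> normal_cone C z" "w \<noteq> 0" for w
  proof -
    obtain r where r: "r > 0" "cball 0 r \<subseteq> C"
      using \<open>0 \<in> interior C\<close> by (auto simp: mem_interior_cball)
    have "(r / norm w) *\<^sub>R w \<in> C" using r that(2) by (intro subsetD[OF r(2)]) simp
    then have "(r / norm w) * (w \<bullet> w) \<le> w \<bullet> z"
      using that(1) by (force simp: normal_cone_def inner_diff_right)
    moreover have "(r / norm w) * (w \<bullet> w) > 0" using r that(2) by simp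
    ultimately show ?thesis by simp
  qed
  have H: "{x. u \<bullet> x = u \<bullet> z} = {x. v \<bullet> x = v \<bullet> z}"
    using assms(1,2) sup[OF u] sup[OF v] unfolding smooth_body_def by blast
  define a where "a = (v \<bullet> z) / (u \<bullet> z)"
  have a: "a > 0" using pos[OF u] pos[OF v] by (simp add: a_def)
  define w where "w = v - a *\<^sub>R u"
  \<comment> \<open>\<open>x\<close> is the projection of \<open>w\<close> along \<open>z\<close>
    onto the hyperplane orthogonal to \<open>u\<close>. As \<open>w\<close> is orthogonal to both
    \<open>x\<close> and \<open>z\<close>, it is orthogonal to itself.\<close>
  define x where "x = w - ((u \<bullet> w) / (u \<bullet> z)) *\<^sub>R z"
  have "u \<bullet> (z + x) = u \<bullet> z" using pos[OF u] by (simp add: x_def inner_diff_left inner_diff_right inner_add_right)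
  then have "v \<bullet> (z + x) = v \<bullet> z" and ux: "u \<bullet> x = 0" using H by (blast, simp add: inner_add_right)
  then have "v \<bullet> x = 0" by (simp add: inner_add_right)
  with ux have "w \<bullet> x = 0" by (simp add: w_def inner_diff_left inner_diff_right inner_add_right)
  moreover have "w \<bullet> z = 0" using pos[OF u] by (simp add: w_def a_def inner_diff_left inner_diff_right inner_add_right)
  ultimately have "w \<bullet> w = 0" by (simp add: x_def inner_diff_left inner_diff_right inner_add_right)
  then have "v = a *\<^sub>R u" by (simp add: w_def)
  with a show ?thesis by (rule that)
qed

section \<open>Closed polygons and their action\<close>

definition action :: "nat \<Rightarrow> (nat \<Rightarrow> 'a::euclidean_space) \<Rightarrow> (nat \<Rightarrow> 'a) \<Rightarrow> real" where
  "action m q p = (\<Sum>j<m. p j \<bullet> (q (Suc j mod m) - q j))"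

lemma sum_cyclic_shift:
  fixes f :: "nat \<Rightarrow> 'b::comm_monoid_add"
  shows "(\<Sum>j<m. f (Suc j mod m)) = (\<Sum>j<m. f j)"
proof (cases m)
  case (Suc n)
  have "(\<Sum>j<n. f (Suc j mod Suc n)) = (\<Sum>j<n. f (Suc j))" by (intro sum.cong) auto
  then have "(\<Sum>j<Suc n. f (Suc j mod Suc n)) = (\<Sum>j<Suc n. f j)"
    by (subst (2) sum.lessThan_Suc_shift) (simp add: add.commute)
  then show ?thesis by (simp add: Suc)
qed simp

lemma Suc_mod_lt: "j < m \<Longrightarrow> Suc j mod m < (m::nat)" by simp

lemma Suc_mod_surj:
  assumes "j < (m::nat)"
  obtains i where "i < m" "Suc i mod m = j" "i = (j + m - 1) mod m"
proof -
  have "Suc ((j + m - 1) mod m) mod m = Suc (j + m - 1) mod m" by (rule mod_Suc_eq)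
  also have "\<dots> = j" using assms by simp
  finally show ?thesis using assms by (intro that[of "(j + m - 1) mod m"]) auto
qed

text \<open>Summation by parts around the cycle. It exchanges the two polygons, so results stated
  for \<open>T\<close> apply to \<open>K\<close> and \<open>- p\<close>; the shift of
  \<open>q\<close> matches the reflection condition at \<open>q (Suc j mod m)\<close>.\<close>

lemma action_dual:
  "action m q p = action m (\<lambda>j. - p j) (\<lambda>j. q (Suc j mod m))"
  using sum_cyclic_shift[of "\<lambda>j. p j \<bullet> q j" m]
  by (simp add: action_def inner_diff_right sum_subtractf inner_commute)

text \<open>The partial sums of \<open>e\<close> are the vertices of a polygon with edges
  \<open>e\<close>; the zero sum closes it at the wrap-around index.\<close>

lemma edges_of_zero_sum:
  fixes e :: "nat \<Rightarrow> 'a::real_vector"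
  assumes "(\<Sum>j<m. e j) = 0" "j < m"
  shows "(\<Sum>i<Suc j mod m. e i) - (\<Sum>i<j. e i) = e j"
proof (cases "Suc j = m")
  case True
  then show ?thesis using assms(1) by (auto simp: add_eq_0_iff)
qed (use assms(2) in auto)

lemma zero_sum_edges: "(\<Sum>j<m. x (Suc j mod m) - x j) = (0::'a::real_vector)"
  using sum_cyclic_shift[of x m] by (simp add: sum_subtractf)

text \<open>Minimise the sum of squared distances from the \<open>y j - c\<close> to \<open>T\<close> over \<open>c\<close>: at a minimum the
  residuals \<open>r j\<close> sum to zero, so they are the edges of a closed polygon, and testing the hypothesis
  with this polygon shows that all residuals vanish.\<close>
lemma translate_into_body:
  fixes T :: "'a::euclidean_space set"
  assumes T: "convex_body T" and "0 < m" and le: "\<And>x. action m x y \<le> ell T m x"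
  obtains c where "\<And>j. j < m \<Longrightarrow> y j - c \<in> T"
proof -
  note T' = convex_bodyD[OF T]
  define f where "f c = (\<Sum>j<m. (infdist (y j - c) T)\<^sup>2)" for c
  obtain B where B: "\<And>x. x \<in> T \<Longrightarrow> norm x \<le> B"
    using compact_imp_bounded[OF T'(1)] by (auto simp: bounded_iff)
  have f_nonneg: "0 \<le> f c" for c by (simp add: f_def sum_nonneg)
  have cont: "continuous_on S f" for S
    unfolding f_def by (intro continuous_intros)
  \<comment> \<open>The sublevel set of \<open>f\<close> at \<open>f 0\<close> lies in the ball of
    radius \<open>R\<close>, so a minimum over this ball is global.\<close>
  define R where "R = norm (y 0) + B + sqrt (f 0)"
  have far: "norm c \<le> R" if "f c \<le> f 0" for c
  proof -
    have "(infdist (y 0 - c) T)\<^sup>2 \<le> f c"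
      unfolding f_def using \<open>0 < m\<close> by (intro member_le_sum[of 0 _ "\<lambda>j. (infdist (y j - c) T)\<^sup>2"]) auto
    then have d: "infdist (y 0 - c) T \<le> sqrt (f 0)" using that real_le_rsqrt by force
    obtain t where t: "t \<in> T" "infdist (y 0 - c) T = dist (y 0 - c) t"
      using infdist_attains_inf[OF T'(6,5)] .
    have "c = y 0 - t - (y 0 - c - t)" by simp
    then have "norm c \<le> norm (y 0) + norm t + norm (y 0 - c - t)"
      by (metis add_right_mono norm_triangle_ineq4 order_trans)
    then show ?thesis using d t B[OF t(1)] by (simp add: R_def dist_norm)
  qed
  have "cball 0 R \<noteq> {}" using far[of 0] by auto
  then obtain c where c: "\<And>z. z \<in> cball 0 R \<Longrightarrow> f c \<le> f z" "c \<in> cball 0 R"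
    using continuous_attains_inf[OF compact_cball _ cont, of 0 R] by metis
  have fmin: "f c \<le> f z" for z
  proof (cases "f z \<le> f 0")
    case True
    then show ?thesis using c(1) far by simp
  next
    case False
    moreover have "f c \<le> f 0" using c(1)[of 0] far[of 0] by simp
    ultimately show ?thesis by simp
  qed
  have "\<exists>t\<in>T. infdist (y j - c) T = dist (y j - c) t" for j
    using infdist_attains_inf[OF T'(6,5)] by metis
  then obtain t where t: "\<And>j. t j \<in> T" "\<And>j. infdist (y j - c) T = dist (y j - c) (t j)"
    by metis
  define r where "r j = y j - c - t j" for j
  have dot: "z \<bullet> r j \<le> t j \<bullet> r j" if "z \<in> T" for z j
  proof -
    have "\<forall>w\<in>T. dist (y j - c) (t j) \<le> dist (y j - c) w"
      using t(2) infdist_le by metis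
    from any_closest_point_dot[OF T'(2,6) t(1) that this]
    show ?thesis by (simp add: r_def inner_diff_right inner_commute)
  qed
  have gr: "gauge (polar T) (r j) = t j \<bullet> r j" for j
    using gauge_polar_attained[OF T, of "r j"] inner_le_gauge_polar[OF T t(1), of j "r j"] dot[of _ j]
    by (metis order_antisym)
  define s where "s = (\<Sum>j<m. r j)"
  \<comment> \<open>Keeping the old nearest points \<open>t j\<close> as competitors bounds
    \<open>f\<close> by a quadratic in \<open>a\<close>. Minimality at \<open>c\<close> gives the
    inequality, and \<open>a = 1 / m\<close> then excludes a nonzero \<open>s\<close>.\<close>
  have key: "2 * a * (s \<bullet> s) \<le> real m * a\<^sup>2 * (s \<bullet> s)" for a :: real
  proof -
    have "f (c + a *\<^sub>R s) \<le> (\<Sum>j<m. (norm (r j - a *\<^sub>R s))\<^sup>2)"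
      unfolding f_def
    proof (intro sum_mono power_mono infdist_nonneg)
      fix j
      show "infdist (y j - (c + a *\<^sub>R s)) T \<le> norm (r j - a *\<^sub>R s)"
        using infdist_le[OF t(1)[of j], of "y j - (c + a *\<^sub>R s)"]
        by (simp add: r_def dist_norm algebra_simps)
    qed
    also have "\<dots> = (\<Sum>j<m. (norm (r j))\<^sup>2 - 2 * a * (r j \<bullet> s) + a\<^sup>2 * (s \<bullet> s))"
      by (intro sum.cong refl)
        (simp add: power2_norm_eq_inner inner_diff_left inner_diff_right inner_commute
          algebra_simps power2_eq_square[of a])
    also have "\<dots> = f c - 2 * a * (s \<bullet> s) + real m * a\<^sup>2 * (s \<bullet> s)"
      unfolding f_def t(2)
      by (simp add: r_def[symmetric] dist_norm sum.distrib sum_subtractf sum_distrib_left[symmetric]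
          inner_sum_left[symmetric] s_def[symmetric])
    finally show ?thesis using fmin[of "c + a *\<^sub>R s"] by simp
  qed
  have "s \<bullet> s = 0"
  proof (rule ccontr)
    assume "s \<bullet> s \<noteq> 0"
    then have "s \<bullet> s > 0" by simp
    then show False using key[of "1 / real m"] \<open>0 < m\<close> by (simp add: power2_eq_square field_simps)
  qed
  then have zero: "(\<Sum>j<m. r j) = 0" by (simp add: s_def)
  define x where "x j = (\<Sum>i<j. r i)" for j
  have x: "x (Suc j mod m) - x j = r j" if "j < m" for j
    unfolding x_def using edges_of_zero_sum[OF zero that] .
  have "action m x y = (\<Sum>j<m. y j \<bullet> r j)" by (simp add: action_def x)
  \<comment> \<open>Since \<open>y j = t j + r j + c\<close> and the edges are the
    \<open>r j\<close>, the action exceeds the length by the sum of the squared residuals.\<close>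
  also have "\<dots> = (\<Sum>j<m. t j \<bullet> r j + r j \<bullet> r j) + c \<bullet> (\<Sum>j<m. r j)"
    unfolding inner_sum_right sum.distrib[symmetric]
    by (intro sum.cong refl) (simp add: r_def inner_diff_left inner_diff_right inner_commute)
  also have "\<dots> = ell T m x + (\<Sum>j<m. r j \<bullet> r j)"
    by (simp add: zero ell_def x gr sum.distrib)
  finally have "(\<Sum>j<m. r j \<bullet> r j) \<le> 0" using le[of x] by simp
  moreover have "(\<Sum>j<m. r j \<bullet> r j) \<ge> 0" by (intro sum_nonneg) auto
  ultimately have "(\<Sum>j<m. r j \<bullet> r j) = 0" by simp
  then have "\<forall>j\<in>{..<m}. r j \<bullet> r j = 0" by (subst sum_nonneg_eq_0_iff[symmetric]) auto
  then have "y j - c = t j" if "j < m" for j using that by (simp add: r_def)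
  then show ?thesis using that t(1) by metis
qed

lemma action_translate: "action m x (\<lambda>j. y j - c) = action m x y"
proof -
  have "(\<Sum>j<m. c \<bullet> (x (Suc j mod m) - x j)) = 0"
    using zero_sum_edges[of x m] by (simp add: inner_sum_right[symmetric])
  then show ?thesis by (simp add: action_def inner_diff_left sum_subtractf)
qed

lemma action_scale: "action m (\<lambda>j. a *\<^sub>R x j) (\<lambda>j. b *\<^sub>R y j) = a * b * action m x y"
  by (simp add: action_def sum_distrib_left scaleR_diff_right[symmetric] mult.assoc mult.left_commute)

lemma ell_scale:
  assumes "convex_body T" "0 \<le> a"
  shows "ell T m (\<lambda>j. a *\<^sub>R x j) = a * ell T m x"
  by (simp add: ell_def sum_distrib_left scaleR_diff_right[symmetric] gauge_polar_scale[OF assms])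

lemma ell_nonneg: "convex_body T \<Longrightarrow> 0 \<le> ell T m x"
  by (simp add: ell_def sum_nonneg gauge_polar_nonneg)

text \<open>The bound places a translate of \<open>y\<close> divided by \<open>s\<close> in
  \<open>T\<close>; equality makes a sum of nonnegative slacks vanish, hence every slack. This
  duality step is applied below to \<open>T\<close> and, through \<open>action_dual\<close>, to
  \<open>K\<close>.\<close>

lemma normals_of_optimal_polygon:
  fixes T :: "'a::euclidean_space set"
  assumes T: "convex_body T" and "0 < m" "0 < s" and le: "\<And>x'. action m x' y \<le> s * ell T m x'"
    and eq: "action m x y = s * ell T m x"
  obtains c where "\<And>j. j < m \<Longrightarrow> (y j - c) /\<^sub>R s \<in> T"
    "\<And>j. j < m \<Longrightarrow> x (Suc j mod m) - x j \<in> normal_cone T ((y j - c) /\<^sub>R s)"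
proof -
  have "action m x' (\<lambda>j. y j /\<^sub>R s) = action m x' y / s" for x'
    using action_scale[of m 1 x' "inverse s" y] by (simp add: field_simps)
  then have "action m x' (\<lambda>j. y j /\<^sub>R s) \<le> ell T m x'" for x'
    using le[of x'] \<open>0 < s\<close> by (simp add: pos_divide_le_eq mult.commute)
  from translate_into_body[OF T \<open>0 < m\<close> this]
  obtain c where c: "\<And>j. j < m \<Longrightarrow> y j /\<^sub>R s - c \<in> T" by metis
  define z where "z j = y j /\<^sub>R s - c" for j
  have z: "z j \<in> T" if "j < m" for j using c[OF that] by (simp add: z_def)
  have zeq: "z = (\<lambda>j. (y j - s *\<^sub>R c) /\<^sub>R s)"
    using \<open>0 < s\<close> by (auto simp: z_def scaleR_diff_right)
  have "action m x z = ell T m x"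
    unfolding z_def using eq \<open>0 < s\<close> action_scale[of m 1 x "inverse s" y] action_translate[of m x "\<lambda>j. y j /\<^sub>R s" c]
    by simp
  then have "(\<Sum>j<m. gauge (polar T) (x (Suc j mod m) - x j) - z j \<bullet> (x (Suc j mod m) - x j)) = 0"
    by (simp add: ell_def action_def sum_subtractf)
  then have "\<forall>j\<in>{..<m}. gauge (polar T) (x (Suc j mod m) - x j) - z j \<bullet> (x (Suc j mod m) - x j) = 0"
    by (subst sum_nonneg_eq_0_iff[symmetric]) (auto simp: inner_le_gauge_polar[OF T z])
  then have "x (Suc j mod m) - x j \<in> normal_cone T (z j)" if "j < m" for j
    using that by (simp add: normal_cone_iff_gauge_polar[OF T z])
  then show ?thesis using that[of "s *\<^sub>R c"] z by (simp add: zeq)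
qed

section \<open>Compactness and continuity for the extremal problem\<close>

lemma compact_finite_box: "compact {x::nat \<Rightarrow> 'a::euclidean_space. \<forall>j. x j \<in> (if j < m then cball 0 R else {0})}"
proof -
  have "{x. \<forall>j. x j \<in> (if j < m then cball 0 R else {0})}
      = PiE UNIV (\<lambda>j. if j < m then cball (0::'a) R else {0})"
    by (auto simp: PiE_def Pi_def)
  moreover have "compactin (product_topology (\<lambda>i. euclidean) UNIV)
      (PiE UNIV (\<lambda>j. if j < m then cball (0::'a) R else {0}))"
    by (auto simp: compactin_PiE)
  ultimately show ?thesis by (simp add: euclidean_product_topology)
qed

lemma ell_continuous:
  assumes "convex_body T"
  shows "continuous_on UNIV (ell T m)"
proof -
  have "continuous_on UNIV (\<lambda>x. gauge (polar T) (x (Suc j mod m) - x j))" for j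
    by (rule continuous_on_compose2[OF gauge_polar_continuous[OF assms]])
      (auto intro!: continuous_intros continuous_on_product_coordinates)
  then show ?thesis unfolding ell_def by (intro continuous_on_sum)
qed

lemma action_continuous: "continuous_on UNIV (\<lambda>z. action m (fst z) (snd z))"
proof -
  have "continuous_on UNIV (\<lambda>z::(nat \<Rightarrow> 'a) \<times> (nat \<Rightarrow> 'a). fst z j)"
       "continuous_on UNIV (\<lambda>z::(nat \<Rightarrow> 'a) \<times> (nat \<Rightarrow> 'a). snd z j)" for j
    by (rule continuous_on_compose2[OF continuous_on_product_coordinates[of j]]; auto intro: continuous_intros)+
  then show ?thesis unfolding action_def by (intro continuous_intros)
qed

text \<open>The walk along the edges from \<open>x 0\<close> to \<open>x j\<close> is part of the
  whole length. The norm is taken relative to \<open>x 0\<close> because the length is translation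
  invariant.\<close>

lemma ell_bounds_norm:
  fixes T :: "'a::euclidean_space set"
  assumes T: "convex_body T"
  obtains R where "R > 0" "\<And>x j. j < m \<Longrightarrow> norm (x j - x 0) \<le> R * ell T m x"
proof -
  obtain r where r: "r > 0" "\<And>v. r * norm v \<le> gauge (polar T) v"
    using gauge_polar_lower_bound[OF T] by blast
  have "r * norm (x j - x 0) \<le> ell T m x" if "j < m" for x j
  proof -
    have "x j - x 0 = (\<Sum>i<j. x (Suc i) - x i)" by (simp add: sum_lessThan_telescope)
    then have "r * norm (x j - x 0) \<le> (\<Sum>i<j. r * norm (x (Suc i) - x i))"
      using norm_sum[of "\<lambda>i. x (Suc i) - x i" "{..<j}"] r(1) by (simp add: sum_distrib_left[symmetric])
    also have "\<dots> \<le> (\<Sum>i<j. gauge (polar T) (x (Suc i mod m) - x i))"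
      using that r(2) by (intro sum_mono) auto
    also have "\<dots> \<le> ell T m x"
      unfolding ell_def using that by (intro sum_mono2) (auto simp: gauge_polar_nonneg[OF T])
    finally show ?thesis .
  qed
  then show ?thesis using r(1) by (intro that[of "1 / r"]) (auto simp: field_simps)
qed

section \<open>Extremal pairs and billiard trajectories\<close>

text \<open>Both sides of the bound scale alike and ignore translations, so the maximum over a
  compact set of normalised pairs is the best constant. The given pair with positive action ensures
  \<open>0 < M\<close>.\<close>

lemma exists_maximal_action:
  fixes K T :: "'a::euclidean_space set" and q p :: "nat \<Rightarrow> 'a"
  assumes K: "convex_body K" and T: "convex_body T" and "0 < action m q p"
  obtains M x y where "0 < M" "action m x y = M" "ell T m x = 1" "ell K m (\<lambda>j. - y j) = 1"
    "\<And>x' y'. action m x' y' \<le> M * ell T m x' * ell K m (\<lambda>j. - y' j)"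
proof -
  have "0 < m" using assms(3) by (cases m) (auto simp: action_def)
  obtain R1 where R1: "R1 > 0" "\<And>x j. j < m \<Longrightarrow> norm (x j - x 0) \<le> R1 * ell T m x"
    using ell_bounds_norm[OF T, of m] by blast
  obtain R2 where R2: "R2 > 0" "\<And>x j. j < m \<Longrightarrow> norm (x j - x 0) \<le> R2 * ell K m x"
    using ell_bounds_norm[OF K, of m] by blast
  \<comment> \<open>Polygons are functions on all of \<open>nat\<close>; pinning the values from
    \<open>m\<close> on to 0 leaves a product of compact sets.\<close>
  define box where "box R = {x::nat \<Rightarrow> 'a. \<forall>j. x j \<in> (if j < m then cball 0 R else {0})}" for R
  define D1 where "D1 = box R1 \<inter> {x. ell T m x \<le> 1}"
  define D2 where "D2 = box R2 \<inter> {x. ell K m (\<lambda>j. - x j) \<le> 1}"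
  have "continuous_on UNIV (\<lambda>x. ell K m (\<lambda>j. - x j))"
    by (rule continuous_on_compose2[OF ell_continuous[OF K]])
      (auto intro!: continuous_on_coordinatewise_then_product continuous_intros continuous_on_product_coordinates)
  then have comp: "compact (D1 \<times> D2)"
    unfolding D1_def D2_def box_def
    by (intro compact_Times compact_Int_closed compact_finite_box closed_Collect_le
        ell_continuous[OF T] continuous_intros)
  have z1: "(\<lambda>j. 0) \<in> D1" and z2: "(\<lambda>j. 0) \<in> D2"
    using R1(1) R2(1) gauge_polar_scale[OF K, of 0 0] gauge_polar_scale[OF T, of 0 0]
    by (auto simp: D1_def D2_def box_def ell_def)
  have "\<exists>z\<in>D1 \<times> D2. \<forall>w\<in>D1 \<times> D2. action m (fst w) (snd w) \<le> action m (fst z) (snd z)"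
    using z1 z2 by (intro continuous_attains_sup comp continuous_on_subset[OF action_continuous]) auto
  then obtain x y where x: "x \<in> D1" and y: "y \<in> D2"
    and max: "\<And>x' y'. x' \<in> D1 \<Longrightarrow> y' \<in> D2 \<Longrightarrow> action m x' y' \<le> action m x y"
    by fastforce
  define M where "M = action m x y"
  have M0: "0 \<le> M" using max[OF z1 z2] by (simp add: M_def action_def)
  define tr where "tr a x' j = (if j < m then a *\<^sub>R (x' j - x' 0) else 0)" for a and x' :: "nat \<Rightarrow> 'a" and j
  have ell_tr: "ell C m (tr a x') = a * ell C m x'" if "convex_body C" "0 \<le> a" for C a x'
    using ell_scale[OF that, of m "\<lambda>j. x' j - x' 0"] by (simp add: ell_def tr_def)
  have bound: "action m x' y' \<le> M * ell T m x' * ell K m (\<lambda>j. - y' j)" for x' y'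
  \<comment> \<open>A polygon of zero length cannot be normalised, but it is constant and the action
    vanishes.\<close>
  proof (cases "ell T m x' = 0 \<or> ell K m (\<lambda>j. - y' j) = 0")
    case True
    then have "action m x' (\<lambda>j. y' j - y' 0) = 0"
    proof
      assume "ell T m x' = 0"
      then have "x' j - x' 0 = 0" if "j < m" for j using R1(2)[OF that, of x'] by simp
      then have "x' (Suc j mod m) - x' j = 0" if "j < m" for j
        using that by (metis Suc_mod_lt eq_iff_diff_eq_0)
      then show ?thesis by (simp add: action_def)
    next
      assume "ell K m (\<lambda>j. - y' j) = 0"
      then have "y' j - y' 0 = 0" if "j < m" for j
        using R2(2)[OF that, of "\<lambda>j. - y' j"] by simp
      then show ?thesis
        unfolding action_def by (intro sum.neutral ballI) (metis inner_zero_left lessThan_iff)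
    qed
    then show ?thesis using True by (auto simp: action_translate)
  next
    case False
    define a where "a = inverse (ell T m x')"
    define b where "b = inverse (ell K m (\<lambda>j. - y' j))"
    have a: "a > 0" "a * ell T m x' = 1" and b: "b > 0" "b * ell K m (\<lambda>j. - y' j) = 1"
      using False ell_nonneg[OF T, of m x'] ell_nonneg[OF K, of m "\<lambda>j. - y' j"] by (auto simp: a_def b_def)
    have neg: "(\<lambda>j. - tr b y' j) = tr b (\<lambda>j. - y' j)" by (auto simp: tr_def scaleR_diff_right)
    have "norm (a *\<^sub>R (x' j - x' 0)) \<le> R1" if "j < m" for j
    proof -
      have "norm (a *\<^sub>R (x' j - x' 0)) \<le> a * (R1 * ell T m x')"
        using R1(2)[OF that, of x'] a(1) by simp
      also have "\<dots> = R1" using a(2) by (simp add: mult.left_commute)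
      finally show ?thesis .
    qed
    then have "tr a x' \<in> D1" using ell_tr[OF T, of a x'] a by (auto simp: D1_def box_def tr_def)
    moreover have "norm (b *\<^sub>R (y' j - y' 0)) \<le> R2" if "j < m" for j
    proof -
      have "norm (b *\<^sub>R (y' j - y' 0)) \<le> b * (R2 * ell K m (\<lambda>j. - y' j))"
        using R2(2)[OF that, of "\<lambda>j. - y' j"] b(1) by (simp add: norm_minus_commute)
      also have "\<dots> = R2" using b(2) by (simp add: mult.left_commute)
      finally show ?thesis .
    qed
    then have "tr b y' \<in> D2" using ell_tr[OF K, of b "\<lambda>j. - y' j"] b neg
      by (auto simp: D2_def box_def tr_def)
    ultimately have "action m (tr a x') (tr b y') \<le> M" unfolding M_def by (rule max)
    moreover have "action m (tr a x') (tr b y') = a * b * action m x' y'"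
    proof -
      have "action m (tr a x') (tr b y') = action m (\<lambda>j. a *\<^sub>R (x' j - x' 0)) (\<lambda>j. b *\<^sub>R (y' j - y' 0))"
        by (simp add: action_def tr_def)
      also have "\<dots> = a * b * action m (\<lambda>j. x' j - x' 0) y'"
        by (simp add: action_scale action_translate)
      finally show ?thesis by (simp add: action_def)
    qed
    ultimately show ?thesis using a(1) b(1) by (simp add: a_def b_def field_simps)
  qed
  have "0 < M" using bound[of q p] assms(3) M0 by (cases "M = 0") auto
  have lx: "ell T m x \<le> 1" and ly: "ell K m (\<lambda>j. - y j) \<le> 1"
    using x y by (auto simp: D1_def D2_def)
  \<comment> \<open>For the maximiser the bound reads \<open>M \<le> M\<close> times the product of
    the two lengths. As neither length exceeds 1, both equal 1.\<close>
  have "1 \<le> ell T m x * ell K m (\<lambda>j. - y j)"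
    using bound[of x y] \<open>0 < M\<close> by (simp add: M_def[symmetric] mult.assoc)
  then have "ell T m x = 1" "ell K m (\<lambda>j. - y j) = 1"
    using lx ly ell_nonneg[OF T, of m x] ell_nonneg[OF K, of m "\<lambda>j. - y j"]
      mult_left_le[OF lx, of "ell K m (\<lambda>j. - y j)"] mult_left_le[OF ly, of "ell T m x"]
    by (auto simp: mult.commute)
  then show ?thesis using that[OF \<open>0 < M\<close> M_def[symmetric]] bound by blast
qed

text \<open>A billiard trajectory in which consecutive vertices of \<open>q\<close> or of \<open>p\<close> may coincide.\<close>
definition weak_billiard ::
  "'a::euclidean_space set \<Rightarrow> 'a set \<Rightarrow> nat \<Rightarrow> (nat \<Rightarrow> 'a) \<Rightarrow> (nat \<Rightarrow> 'a) \<Rightarrow> bool" where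
  "weak_billiard K T m q p \<longleftrightarrow> (\<forall>j<m. q j \<in> K \<and> p j \<in> T \<and>
     q (Suc j mod m) - q j \<in> normal_cone T (p j) \<and>
     p j - p (Suc j mod m) \<in> normal_cone K (q (Suc j mod m)))"

lemma weak_billiard_action:
  assumes "convex_body T" "weak_billiard K T m q p"
  shows "action m q p = ell T m q"
  unfolding action_def ell_def
  using assms(2) by (intro sum.cong refl) (auto simp: weak_billiard_def normal_cone_iff_gauge_polar[OF assms(1)])

text \<open>After summation by parts the reflection conditions are equality cases for
  \<open>K\<close>. With \<open>weak_billiard_action\<close> it follows that \<open>q\<close> and
  \<open>- p\<close> have equal lengths.\<close>

lemma weak_billiard_dual_action:
  assumes "convex_body K" "weak_billiard K T m q p"
  shows "action m q p = ell K m (\<lambda>j. - p j)"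
  unfolding action_dual[of m q p] unfolding action_def ell_def
proof (intro sum.cong refl)
  fix j assume "j \<in> {..<m}"
  then have "j < m" "Suc j mod m < m" by auto
  then have "q (Suc j mod m) \<in> K" "- p (Suc j mod m) - - p j \<in> normal_cone K (q (Suc j mod m))"
    using assms(2) by (auto simp: weak_billiard_def)
  then show "q (Suc j mod m) \<bullet> (- p (Suc j mod m) - - p j)
      = gauge (polar K) (- p (Suc j mod m) - - p j)"
    using normal_cone_iff_gauge_polar[OF assms(1)] by blast
qed

text \<open>Each polygon of a maximal pair is optimal when the other is held fixed, so
  \<open>normals_of_optimal_polygon\<close> yields both families of normality conditions.\<close>

lemma exists_weak_billiard:
  fixes K T :: "'a::euclidean_space set" and q p :: "nat \<Rightarrow> 'a"
  assumes K: "convex_body K" and T: "convex_body T" and "0 < action m q p"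
  obtains M x y where "0 < M" "weak_billiard K T m x y" "action m x y = 1 / M"
    "\<And>x' y'. action m x' y' \<le> M * ell T m x' * ell K m (\<lambda>j. - y' j)"
proof -
  have "0 < m" using assms(3) by (cases m) (auto simp: action_def)
  obtain M x y where M: "0 < M" "action m x y = M" and l: "ell T m x = 1" "ell K m (\<lambda>j. - y j) = 1"
    and le: "\<And>x' y'. action m x' y' \<le> M * ell T m x' * ell K m (\<lambda>j. - y' j)"
    using exists_maximal_action[OF assms] by metis
  have "action m x' y \<le> M * ell T m x'" for x' using le[of x' y] l by simp
  moreover have "action m x y = M * ell T m x" using M l by simp
  ultimately obtain c where c: "\<And>j. j < m \<Longrightarrow> (y j - c) /\<^sub>R M \<in> T"
    "\<And>j. j < m \<Longrightarrow> x (Suc j mod m) - x j \<in> normal_cone T ((y j - c) /\<^sub>R M)"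
    using normals_of_optimal_polygon[OF T \<open>0 < m\<close> M(1)] by metis
  have "action m x' (\<lambda>j. x (Suc j mod m)) \<le> M * ell K m x'" for x'
    using le[of x "\<lambda>j. - x' j"] l by (simp add: action_dual[of m x "\<lambda>j. - x' j"])
  moreover have "action m (\<lambda>j. - y j) (\<lambda>j. x (Suc j mod m)) = M * ell K m (\<lambda>j. - y j)"
    using M l by (simp add: action_dual[of m x y])
  ultimately obtain d where d: "\<And>j. j < m \<Longrightarrow> (x (Suc j mod m) - d) /\<^sub>R M \<in> K"
    "\<And>j. j < m \<Longrightarrow> - y (Suc j mod m) - - y j \<in> normal_cone K ((x (Suc j mod m) - d) /\<^sub>R M)"
    using normals_of_optimal_polygon[OF K \<open>0 < m\<close> M(1), of "\<lambda>j. x (Suc j mod m)" "\<lambda>j. - y j"] by metis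
  \<comment> \<open>Dividing both polygons by \<open>M\<close> places translates of them in the
    bodies and turns the action \<open>M\<close> into \<open>1 / M\<close>.\<close>
  define q' where "q' j = (x j - d) /\<^sub>R M" for j
  define p' where "p' j = (y j - c) /\<^sub>R M" for j
  have "weak_billiard K T m q' p'"
    unfolding weak_billiard_def
  proof (intro allI impI conjI)
    fix j assume j: "j < m"
    show "q' j \<in> K" using Suc_mod_surj[OF j] d(1) unfolding q'_def by metis
    show "p' j \<in> T" using c(1)[OF j] by (simp add: p'_def)
    have "inverse M *\<^sub>R (x (Suc j mod m) - x j) \<in> normal_cone T (p' j)"
      using c(2)[OF j] M(1) by (intro normal_cone_scale) (auto simp: p'_def)
    then show "q' (Suc j mod m) - q' j \<in> normal_cone T (p' j)"
      by (simp add: q'_def scaleR_diff_right[symmetric])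
    have "inverse M *\<^sub>R (y j - y (Suc j mod m)) \<in> normal_cone K (q' (Suc j mod m))"
      using d(2)[OF j] M(1) by (intro normal_cone_scale) (auto simp: q'_def)
    then show "p' j - p' (Suc j mod m) \<in> normal_cone K (q' (Suc j mod m))"
      by (simp add: p'_def scaleR_diff_right[symmetric])
  qed
  moreover have "action m q' p' = 1 / M"
  proof -
    have "action m q' p' = inverse M * inverse M * action m (\<lambda>j. x j - d) y"
      unfolding q'_def p'_def by (simp add: action_scale action_translate)
    also have "action m (\<lambda>j. x j - d) y = M" using M(2) by (simp add: action_def)
    finally show ?thesis using M(1) by (simp add: field_simps)
  qed
  ultimately show ?thesis using that M(1) le by blast
qed

section \<open>Rotation and removal of degenerate vertices\<close>

lemma rotate_Suc_mod: "(Suc j mod m + r) mod m = Suc ((j + r) mod m) mod (m::nat)"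
  by (simp add: mod_simps)

lemma sum_rotate:
  fixes f :: "nat \<Rightarrow> 'b::comm_monoid_add"
  shows "(\<Sum>j<m. f ((j + r) mod m)) = (\<Sum>j<m. f j)"
proof (induction r)
  case (Suc r)
  have "(\<Sum>j<m. f ((j + Suc r) mod m)) = (\<Sum>j<m. f ((Suc j mod m + r) mod m))"
    by (simp add: mod_simps)
  also have "\<dots> = (\<Sum>j<m. f ((j + r) mod m))"
    using sum_cyclic_shift[of "\<lambda>j. f ((j + r) mod m)" m] .
  finally show ?case using Suc by simp
qed simp

lemma weak_billiard_rotate:
  assumes "weak_billiard K T m q p"
  shows "weak_billiard K T m (\<lambda>j. q ((j + r) mod m)) (\<lambda>j. p ((j + r) mod m))"
  using assms unfolding weak_billiard_def rotate_Suc_mod by auto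

lemma action_rotate: "action m (\<lambda>j. q ((j + r) mod m)) (\<lambda>j. p ((j + r) mod m)) = action m q p"
  unfolding action_def rotate_Suc_mod
  using sum_rotate[of "\<lambda>j. p j \<bullet> (q (Suc j mod m) - q j)" r m] .

text \<open>A repeated vertex of one polygon makes two consecutive edges of the other normal at the
  same point, so their sum, the edge left after the removal, is normal there too.\<close>

lemma weak_billiard_drop_last:
  assumes w: "weak_billiard K T (Suc (Suc n)) q p"
    and degen: "q (Suc n) = q 0 \<or> p n = p (Suc n)"
  shows "weak_billiard K T (Suc n) q p" "action (Suc n) q p = action (Suc (Suc n)) q p"
proof -
  have "q (Suc n) - q n \<in> normal_cone T (p n)" "q 0 - q (Suc n) \<in> normal_cone T (p (Suc n))"
    "p n - p (Suc n) \<in> normal_cone K (q (Suc n))" "p (Suc n) - p 0 \<in> normal_cone K (q 0)"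
    using w[unfolded weak_billiard_def, rule_format, of n] w[unfolded weak_billiard_def, rule_format, of "Suc n"]
    by auto
  then have last: "q 0 - q n \<in> normal_cone T (p n)" "p n - p 0 \<in> normal_cone K (q 0)"
    using degen normal_cone_add[of "q (Suc n) - q n" T "p n" "q 0 - q (Suc n)"]
      normal_cone_add[of "p n - p (Suc n)" K "q 0" "p (Suc n) - p 0"] by auto
  show "weak_billiard K T (Suc n) q p"
    unfolding weak_billiard_def
  proof (intro allI impI)
    fix j assume "j < Suc n"
    then consider "j = n" | "j < n" by linarith
    then show "q j \<in> K \<and> p j \<in> T \<and> q (Suc j mod Suc n) - q j \<in> normal_cone T (p j) \<and>
        p j - p (Suc j mod Suc n) \<in> normal_cone K (q (Suc j mod Suc n))"
      using w[unfolded weak_billiard_def, rule_format, of j] last by cases auto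
  qed
  have "(\<Sum>j<n. p j \<bullet> (q (Suc j mod Suc n) - q j)) = (\<Sum>j<n. p j \<bullet> (q (Suc j) - q j))"
    "(\<Sum>j<n. p j \<bullet> (q (Suc j mod Suc (Suc n)) - q j)) = (\<Sum>j<n. p j \<bullet> (q (Suc j) - q j))"
    by (intro sum.cong; simp)+
  then show "action (Suc n) q p = action (Suc (Suc n)) q p"
    using degen by (auto simp: action_def inner_diff_right)
qed

text \<open>Rotate a degenerate vertex to the last position, drop it and repeat. Positive action
  keeps at least two vertices throughout.\<close>

lemma weak_billiard_prune:
  assumes "weak_billiard K T m q p" "0 < action m q p"
  obtains m' q' p' where "weak_billiard K T m' q' p'" "action m' q' p' = action m q p"
    "\<And>j. j < m' \<Longrightarrow> q' (Suc j mod m') \<noteq> q' j" "\<And>j. j < m' \<Longrightarrow> p' (Suc j mod m') \<noteq> p' j"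
  using assms
proof (induction m arbitrary: q p thesis rule: less_induct)
  case (less m)
  show ?case
  proof (cases "\<exists>j<m. q (Suc j mod m) = q j \<or> p (Suc j mod m) = p j")
    case False
    then show ?thesis using less.prems by blast
  next
    case True
    then obtain i where i: "i < m" "q (Suc i mod m) = q i \<or> p (Suc i mod m) = p i" by auto
    have "m \<noteq> 0" using i(1) by simp
    moreover have "m \<noteq> 1" using less.prems(3) by (auto simp: action_def)
    ultimately obtain n where m: "m = Suc (Suc n)" by (metis One_nat_def not0_implies_Suc)
    \<comment> \<open>The shifts differ by one because \<open>weak_billiard_drop_last\<close>
      compares the last \<open>q\<close> with its successor but the last \<open>p\<close> with its
      predecessor.\<close>
    obtain r where r: "q ((Suc n + r) mod m) = q ((0 + r) mod m)
        \<or> p ((n + r) mod m) = p ((Suc n + r) mod m)"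
    proof (cases "q (Suc i mod m) = q i")
      case True
      have "Suc n + Suc i = i + m" by (simp add: m)
      then have "(Suc n + Suc i) mod m = i" using i(1) by (simp only: mod_add_self2 mod_less)
      then show ?thesis using True that[of "Suc i"] by simp
    next
      case False
      have "n + (i + 2) = i + m" "Suc n + (i + 2) = Suc i + m" by (auto simp: m)
      then have "(n + (i + 2)) mod m = i" "(Suc n + (i + 2)) mod m = Suc i mod m"
        using i(1) by (simp_all only: mod_add_self2 mod_less)
      then show ?thesis using False i(2) that[of "i + 2"] by simp
    qed
    define q1 where "q1 = (\<lambda>j. q ((j + r) mod m))"
    define p1 where "p1 = (\<lambda>j. p ((j + r) mod m))"
    have "weak_billiard K T m q1 p1" "action m q1 p1 = action m q p"
      using weak_billiard_rotate[OF less.prems(2)] action_rotate unfolding q1_def p1_def by auto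
    moreover have "q1 (Suc n) = q1 0 \<or> p1 n = p1 (Suc n)" using r by (simp add: q1_def p1_def)
    ultimately have "weak_billiard K T (Suc n) q1 p1" "action (Suc n) q1 p1 = action m q p"
      using weak_billiard_drop_last[of K T n q1 p1] by (auto simp: m)
    then show ?thesis
      using less.IH[of "Suc n" q1 p1] less.prems(1,3) by (auto simp: m)
  qed
qed

text \<open>Nonzero normals put the vertices on the boundaries. A vertex on the segment between its
  neighbours would be interior to \<open>K\<close> by strict convexity.\<close>

lemma minkowski_billiard_of_weak:
  assumes K: "convex_body K" "strictly_convex K" and T: "convex_body T"
    and w: "weak_billiard K T m q p" and "2 \<le> m"
    and q: "\<And>j. j < m \<Longrightarrow> q (Suc j mod m) \<noteq> q j" and p: "\<And>j. j < m \<Longrightarrow> p (Suc j mod m) \<noteq> p j"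
  shows "minkowski_billiard K T m q"
proof -
  note w' = w[unfolded weak_billiard_def, rule_format]
  have qf: "q j \<in> frontier K" if j: "j < m" for j
  proof -
    obtain i where i: "i < m" "Suc i mod m = j" using Suc_mod_surj[OF j] by metis
    show ?thesis
      using normal_cone_frontier[of "q j" K "p i - p j"] w'[OF i(1)] w'[OF j] p[OF i(1)] i(2) by auto
  qed
  have pf: "p j \<in> frontier T" if j: "j < m" for j
    using normal_cone_frontier[of "p j" T "q (Suc j mod m) - q j"] w'[OF j] q[OF j] by auto
  have "q j \<notin> closed_segment (q ((j + m - 1) mod m)) (q (Suc j mod m))" if j: "j < m" for j
  proof
    assume seg: "q j \<in> closed_segment (q ((j + m - 1) mod m)) (q (Suc j mod m))"
    obtain i where i: "i < m" "Suc i mod m = j" "i = (j + m - 1) mod m"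
      using Suc_mod_surj[OF j] by metis
    have "q j \<in> open_segment (q i) (q (Suc j mod m))"
      using seg q[OF i(1)] q[OF j] i by (auto simp: open_segment_def)
    moreover from this have "q i \<noteq> q (Suc j mod m)" by auto
    moreover have "q i \<in> K" "q (Suc j mod m) \<in> K" using w'[of i] w'[of "Suc j mod m"] i j by auto
    ultimately have "q j \<in> interior K" using K(2) unfolding strictly_convex_def by blast
    then show False using qf[OF j] by (simp add: frontier_def)
  qed
  moreover have "p (Suc j mod m) - p j \<in> uminus ` normal_cone K (q (Suc j mod m))" if "j < m" for j
    using w'[OF that] by (auto simp: image_iff intro!: bexI[of _ "p j - p (Suc j mod m)"])
  ultimately show ?thesis
    unfolding minkowski_billiard_def closed_polygonal_def
    using \<open>2 \<le> m\<close> qf pf w' q by (intro conjI allI impI exI[of _ p]) (auto dest: sym)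
qed

section \<open>Affine independence of the vertices\<close>

text \<open>If two consecutive \<open>p\<close> agreed, the two edges of \<open>q\<close> meeting
  there would be normal to \<open>T\<close> at one point. By smoothness they would be positively
  parallel, placing a vertex of \<open>q\<close> between its neighbours.\<close>

lemma weak_billiard_of_minkowski:
  fixes K T :: "'a::euclidean_space set"
  assumes K: "convex_body K" and T: "convex_body T" "smooth_body T"
    and q: "minkowski_billiard K T m q"
  obtains p where "weak_billiard K T m q p" "\<And>j. j < m \<Longrightarrow> p (Suc j mod m) \<noteq> p j"
proof -
  obtain p where p: "\<And>j. j < m \<Longrightarrow> p j \<in> frontier T"
      "\<And>j. j < m \<Longrightarrow> q (Suc j mod m) - q j \<in> normal_cone T (p j)"
      "\<And>j. j < m \<Longrightarrow> p (Suc j mod m) - p j \<in> uminus ` normal_cone K (q (Suc j mod m))"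
    and poly: "closed_polygonal m q" and qf: "\<And>j. j < m \<Longrightarrow> q j \<in> frontier K"
    using q unfolding minkowski_billiard_def by metis
  have "p j - p (Suc j mod m) \<in> normal_cone K (q (Suc j mod m))" if "j < m" for j
  proof -
    obtain v where v: "v \<in> normal_cone K (q (Suc j mod m))" "p (Suc j mod m) - p j = - v"
      using p(3)[of j] \<open>j < m\<close> by blast
    then have "p j - p (Suc j mod m) = v" by (metis minus_diff_eq minus_minus)
    then show ?thesis using v(1) by simp
  qed
  moreover have "q j \<in> K" "p j \<in> T" if "j < m" for j
    using qf[OF that] p(1)[OF that] frontier_subset_closed convex_bodyD(6)[OF K] convex_bodyD(6)[OF T(1)]
    by blast+
  ultimately have w: "weak_billiard K T m q p" using p(2) by (simp add: weak_billiard_def)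
  have "p (Suc j mod m) \<noteq> p j" if j: "j < m" for j
  proof
    assume eq: "p (Suc j mod m) = p j"
    define k where "k = Suc j mod m"
    have k: "k < m" using j by (simp add: k_def)
    have pred: "(k + m - 1) mod m = j"
    proof (cases "Suc j = m")
      case False
      then show ?thesis using j by (simp add: k_def)
    qed (simp add: k_def flip: Suc_pred)
    have ne: "q k - q j \<noteq> 0" "q (Suc k mod m) - q k \<noteq> 0"
      and nseg: "q k \<notin> closed_segment (q j) (q (Suc k mod m))"
      using poly[unfolded closed_polygonal_def, THEN conjunct2, rule_format, OF j]
        poly[unfolded closed_polygonal_def, THEN conjunct2, rule_format, OF k]
      unfolding pred k_def[symmetric] by auto
    have "q k - q j \<in> normal_cone T (p j)" "q (Suc k mod m) - q k \<in> normal_cone T (p j)"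
      using p(2)[OF j] p(2)[OF k] eq by (auto simp: k_def)
    then obtain a where a: "a > 0" "q (Suc k mod m) - q k = a *\<^sub>R (q k - q j)"
      using smooth_normal_proportional[OF T(2) p(1)[OF j]] ne convex_bodyD(3)[OF T(1)] by metis
    define t where "t = 1 / (1 + a)"
    have t: "0 \<le> t" "t \<le> 1" "t * (1 + a) = 1" using a(1) by (auto simp: t_def)
    have "q (Suc k mod m) - q j = (1 + a) *\<^sub>R (q k - q j)"
      using a(2) by (simp add: scaleR_add_left) (metis add.commute diff_add_cancel add_diff_eq)
    then have "t *\<^sub>R (q (Suc k mod m) - q j) = q k - q j" using t(3) by simp
    then have "q k = (1 - t) *\<^sub>R q j + t *\<^sub>R q (Suc k mod m)"
      by (simp add: algebra_simps)
    then show False using nseg t by (auto simp: in_segment)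
  qed
  then show ?thesis using that w by blast
qed

text \<open>The extremal pair of polygons yields a billiard trajectory whose length is the reciprocal of
  the best constant, so the best constant is at most \<open>1 / ell T m q\<close>.\<close>
lemma minimizing_action_bound:
  fixes K T :: "'a::euclidean_space set"
  assumes K: "convex_body K" "strictly_convex K" and T: "convex_body T"
    and min: "ell_minimizing K T m q" and w: "weak_billiard K T m q p" and pos: "0 < ell T m q"
  shows "ell T m q * action m x y \<le> ell T m x * ell K m (\<lambda>j. - y j)"
proof -
  have "0 < action m q p" using weak_billiard_action[OF T w] pos by simp
  then obtain M x0 y0 where M: "0 < M" "weak_billiard K T m x0 y0" "action m x0 y0 = 1 / M"
    and le: "action m x y \<le> M * ell T m x * ell K m (\<lambda>j. - y j)"
    using exists_weak_billiard[OF K(1) T] by metis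
  have "0 < action m x0 y0" using M by simp
  then obtain m' q' p' where w': "weak_billiard K T m' q' p'" "action m' q' p' = 1 / M"
    "\<And>j. j < m' \<Longrightarrow> q' (Suc j mod m') \<noteq> q' j" "\<And>j. j < m' \<Longrightarrow> p' (Suc j mod m') \<noteq> p' j"
    using weak_billiard_prune[OF M(2)] M(3) by metis
  \<comment> \<open>With fewer than two vertices all edges, and hence the action, would
    vanish.\<close>
  have "m' \<noteq> 0" using w'(2) M(1) by (intro notI) (simp add: action_def)
  moreover have "m' \<noteq> 1" using w'(2) M(1) by (intro notI) (simp add: action_def)
  ultimately have "minkowski_billiard K T m' q'"
    by (intro minkowski_billiard_of_weak[OF K T w'(1)] w') auto
  then have "ell T m q \<le> ell T m' q'" using min by (auto simp: ell_minimizing_def)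
  also have "\<dots> = 1 / M" using weak_billiard_action[OF T w'(1)] w'(2) by simp
  finally have LM: "ell T m q * M \<le> 1" using M(1) by (simp add: field_simps)
  have "ell T m q * action m x y \<le> (ell T m q * M) * (ell T m x * ell K m (\<lambda>j. - y j))"
    using mult_left_mono[OF le, of "ell T m q"] pos by (simp add: ac_simps)
  also have "\<dots> \<le> ell T m x * ell K m (\<lambda>j. - y j)"
    by (rule mult_left_le_one_le)
      (use LM pos M(1) ell_nonneg[OF K(1)] ell_nonneg[OF T] in \<open>auto intro!: mult_nonneg_nonneg\<close>)
  finally show ?thesis .
qed

text \<open>A polygon with edges \<open>(1 + \<epsilon> d\<^sub>j) e\<^sub>j\<close> still has all edges normal to \<open>T\<close> at the \<open>p j\<close>, so
  together with \<open>p\<close> it is again extremal. Strict convexity of \<open>K\<close> then forces it to be homothetic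
  to \<open>q\<close>.\<close>
lemma edge_relation_constant:
  fixes K T :: "'a::euclidean_space set"
  assumes K: "convex_body K" "strictly_convex K" and T: "convex_body T"
    and w: "weak_billiard K T m q p"
    and qne: "\<And>j. j < m \<Longrightarrow> q (Suc j mod m) \<noteq> q j"
    and pne: "\<And>j. j < m \<Longrightarrow> p (Suc j mod m) \<noteq> p j"
    and bound: "\<And>x y. ell T m q * action m x y \<le> ell T m x * ell K m (\<lambda>j. - y j)"
    and d: "(\<Sum>j<m. d j *\<^sub>R (q (Suc j mod m) - q j)) = 0"
    and "i < m" "j < m"
  shows "d i = d j"
proof -
  note w' = w[unfolded weak_billiard_def, rule_format]
  have "0 < m" using \<open>i < m\<close> by simp
  have gauge_pos: "gauge (polar T) v > 0" if "v \<noteq> 0" for v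
  proof -
    obtain r where "r > 0" "\<And>v. r * norm v \<le> gauge (polar T) v"
      using gauge_polar_lower_bound[OF T] by blast
    then have "r * norm v > 0" "r * norm v \<le> gauge (polar T) v" using that by auto
    then show ?thesis by linarith
  qed
  have ell_pos: "0 < ell T m x" if "\<And>j. j < m \<Longrightarrow> x (Suc j mod m) - x j \<noteq> 0" for x
    unfolding ell_def using that \<open>0 < m\<close> by (intro sum_pos) (auto intro!: gauge_pos)
  \<comment> \<open>\<open>S\<close> exceeds every \<open>\<bar>d j\<bar>\<close>, so the factors
    \<open>t j\<close> are positive and preserve normality.\<close>
  define S where "S = 1 + (\<Sum>j<m. \<bar>d j\<bar>)"
  have S: "0 < S" by (simp add: S_def sum_nonneg add_pos_nonneg)
  define t where "t j = 1 + inverse S * d j" for j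
  have t: "t j > 0" if "j < m" for j
  proof -
    have "\<bar>d j\<bar> \<le> (\<Sum>j<m. \<bar>d j\<bar>)" using that by (intro member_le_sum) auto
    then have "- d j < S" by (simp add: S_def)
    then show ?thesis using S by (simp add: t_def field_simps)
  qed
  have "(\<Sum>j<m. t j *\<^sub>R (q (Suc j mod m) - q j))
      = (\<Sum>j<m. q (Suc j mod m) - q j) + inverse S *\<^sub>R (\<Sum>j<m. d j *\<^sub>R (q (Suc j mod m) - q j))"
    unfolding scaleR_sum_right sum.distrib[symmetric]
    by (intro sum.cong refl) (simp add: t_def scaleR_add_left)
  then have sum0: "(\<Sum>j<m. t j *\<^sub>R (q (Suc j mod m) - q j)) = 0" using d by (simp add: zero_sum_edges)
  define x where "x j = (\<Sum>i<j. t i *\<^sub>R (q (Suc i mod m) - q i))" for j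
  have x: "x (Suc j mod m) - x j = t j *\<^sub>R (q (Suc j mod m) - q j)" if "j < m" for j
    unfolding x_def using edges_of_zero_sum[OF sum0 that] .
  have xpos: "0 < ell T m x" using x t qne by (intro ell_pos) force
  have qpos: "0 < ell T m q" using qne by (intro ell_pos) force
  define s where "s = ell T m x / ell T m q"
  have s: "s > 0" using xpos qpos by (simp add: s_def)
  have act: "action m x p = ell T m x"
    unfolding action_def ell_def
  proof (intro sum.cong refl)
    fix j assume "j \<in> {..<m}"
    then have j: "j < m" by simp
    have "x (Suc j mod m) - x j \<in> normal_cone T (p j)"
      unfolding x[OF j] using w'[OF j] t[OF j] by (intro normal_cone_scale) auto
    then show "p j \<bullet> (x (Suc j mod m) - x j) = gauge (polar T) (x (Suc j mod m) - x j)"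
      using normal_cone_iff_gauge_polar[OF T] w'[OF j] by blast
  qed
  have Kp: "ell K m (\<lambda>j. - p j) = ell T m q"
    using weak_billiard_action[OF T w] weak_billiard_dual_action[OF K(1) w] by simp
  \<comment> \<open>The pair of \<open>x\<close> and \<open>p\<close> attains \<open>bound\<close>,
    so \<open>- p\<close> is optimal for the shifted \<open>x\<close> with constant
    \<open>s\<close>.\<close>
  have "action m y (\<lambda>j. x (Suc j mod m)) \<le> s * ell K m y" for y
    using bound[of x "\<lambda>j. - y j"] qpos
    by (simp add: action_dual[of m x "\<lambda>j. - y j"] s_def field_simps)
  moreover have "action m (\<lambda>j. - p j) (\<lambda>j. x (Suc j mod m)) = s * ell K m (\<lambda>j. - p j)"
    using act qpos by (simp add: action_dual[of m x p] Kp s_def)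
  ultimately obtain c where c: "\<And>j. j < m \<Longrightarrow> (x (Suc j mod m) - c) /\<^sub>R s \<in> K"
    "\<And>j. j < m \<Longrightarrow> - p (Suc j mod m) - - p j \<in> normal_cone K ((x (Suc j mod m) - c) /\<^sub>R s)"
    using normals_of_optimal_polygon[OF K(1) \<open>0 < m\<close> s, of "\<lambda>j. x (Suc j mod m)" "\<lambda>j. - p j"] by metis
  \<comment> \<open>The rescaled vertex of \<open>x\<close> and \<open>q j\<close> share the nonzero
    normal \<open>p i - p j\<close> of \<open>K\<close>, so they coincide.\<close>
  have hom: "x j = c + s *\<^sub>R q j" if j: "j < m" for j
  proof -
    obtain i where i: "i < m" "Suc i mod m = j" using Suc_mod_surj[OF j] by metis
    have "(x j - c) /\<^sub>R s = q j"
      using c[OF i(1)] w'[OF i(1)] w'[OF j] pne[OF i(1)] i(2)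
      by (intro strictly_convex_normal_unique[OF K(2), of _ _ "p i - p j"]) auto
    then have "s *\<^sub>R ((x j - c) /\<^sub>R s) = s *\<^sub>R q j" by simp
    then show ?thesis using s by (simp add: algebra_simps)
  qed
  have ts: "t j = s" if j: "j < m" for j
  proof -
    have "t j *\<^sub>R (q (Suc j mod m) - q j) = s *\<^sub>R (q (Suc j mod m) - q j)"
      using x[OF j] hom[OF j] hom[of "Suc j mod m"] j by (simp add: scaleR_diff_right)
    then show ?thesis using qne[OF j] by simp
  qed
  have "inverse S * d i = inverse S * d j" using ts[OF \<open>i < m\<close>] ts[OF \<open>j < m\<close>] unfolding t_def by linarith
  then show ?thesis using S by simp
qed

text \<open>Summation by parts turns an affine relation \<open>u\<close> between vertices into an
  edge relation whose coefficients are partial sums of \<open>u\<close>. If these are all equal,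
  their differences \<open>u\<close> vanish.\<close>

lemma vertex_relation_trivial:
  fixes q :: "nat \<Rightarrow> 'a::real_vector"
  assumes edges: "\<And>d i j. (\<Sum>j<m. d j *\<^sub>R (q (Suc j mod m) - q j)) = 0 \<Longrightarrow> i < m \<Longrightarrow> j < m \<Longrightarrow> d i = d j"
    and u: "(\<Sum>j<m. u j) = (0::real)" "(\<Sum>j<m. u j *\<^sub>R q j) = 0" and "k < m"
  shows "u k = 0"
proof -
  define D where "D j = (\<Sum>i<j. u i)" for j
  have D: "D (Suc j mod m) - D j = u j" if "j < m" for j
    unfolding D_def using edges_of_zero_sum[OF u(1) that] .
  have "(\<Sum>j<m. D (Suc j mod m) *\<^sub>R (q (Suc j mod m) - q j))
      = (\<Sum>j<m. D (Suc j mod m) *\<^sub>R q (Suc j mod m)) - (\<Sum>j<m. D j *\<^sub>R q j) - (\<Sum>j<m. u j *\<^sub>R q j)"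
    unfolding sum_subtractf[symmetric]
    by (intro sum.cong refl) (simp add: D[symmetric] algebra_simps)
  also have "\<dots> = 0" using u(2) sum_cyclic_shift[of "\<lambda>j. D j *\<^sub>R q j" m] by simp
  finally have const: "D (Suc i mod m) = D (Suc j mod m)" if "i < m" "j < m" for i j
    using edges[of "\<lambda>j. D (Suc j mod m)" i j] that by simp
  obtain i where "i < m" "Suc i mod m = k" using Suc_mod_surj[OF \<open>k < m\<close>] by metis
  then show ?thesis using const[of k i] D[OF \<open>k < m\<close>] \<open>k < m\<close> by simp
qed

lemma aff_dim_vertices:
  fixes q :: "nat \<Rightarrow> 'a::euclidean_space"
  assumes triv: "\<And>u k. (\<Sum>j<m. u j) = (0::real) \<Longrightarrow> (\<Sum>j<m. u j *\<^sub>R q j) = 0 \<Longrightarrow> k < m \<Longrightarrow> u k = 0"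
  shows "aff_dim (q ` {..<m}) = int m - 1"
proof -
  \<comment> \<open>Affine independence concerns the set of vertices, so repetitions are excluded
    first: one would give a relation with coefficients 1 and -1.\<close>
  have inj: "inj_on q {..<m}"
  proof (rule inj_onI, rule ccontr)
    fix i j assume ij: "i \<in> {..<m}" "j \<in> {..<m}" "q i = q j" "i \<noteq> j"
    define u where "u k = (if k = i then 1 else 0) - (if k = j then 1 else 0 :: real)" for k
    have "(\<Sum>k<m. u k) = 0" "(\<Sum>k<m. u k *\<^sub>R q k) = 0"
      using ij by (auto simp: u_def sum_subtractf scaleR_diff_left if_distrib[of "\<lambda>c. c *\<^sub>R _"] cong: if_cong)
    from triv[OF this, of i] ij show False by (simp add: u_def)
  qed
  have "\<not> affine_dependent (q ` {..<m})"
    using triv by (auto simp: affine_dependent_explicit_finite sum.reindex[OF inj] o_def)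
  then show ?thesis
    using aff_dim_affine_independent[of "q ` {..<m}"] inj by (simp add: card_image)
qed

theorem theorem1p4:
  fixes K T V :: "'a::euclidean_space set" and q :: "nat \<Rightarrow> 'a" and m :: nat
  assumes "convex_body K" "strictly_convex K" "smooth_body K"
    and "convex_body T" "strictly_convex T" "smooth_body T"
    and "ell_minimizing K T m q"
    and "affine V" "q ` {..<m} \<subseteq> K \<inter> V"
    and "\<forall>W. affine W \<and> q ` {..<m} \<subseteq> K \<inter> W \<and> K \<inter> W \<subseteq> K \<inter> V \<longrightarrow> K \<inter> W = K \<inter> V"
  shows "aff_dim V = int m - 1 \<and> aff_dim (convex hull (q ` {..<m})) = int m - 1"
proof -
  note K = assms(1,2) and T = assms(4,6) and min = assms(7)
  have mb: "minkowski_billiard K T m q" using min by (simp add: ell_minimizing_def)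
  obtain p where w: "weak_billiard K T m q p" and pne: "\<And>j. j < m \<Longrightarrow> p (Suc j mod m) \<noteq> p j"
    using weak_billiard_of_minkowski[OF K(1) T mb] by blast
  have m: "2 \<le> m" and qne: "\<And>j. j < m \<Longrightarrow> q (Suc j mod m) \<noteq> q j"
    using mb unfolding minkowski_billiard_def closed_polygonal_def by auto
  have "0 < ell T m q"
  proof -
    obtain R where "\<And>x j. j < m \<Longrightarrow> norm (x j - x 0) \<le> R * ell T m x"
      using ell_bounds_norm[OF T(1), of m] by blast
    from this[of 1 q] have "ell T m q \<noteq> 0" using m qne[of 0] by auto
    then show ?thesis using ell_nonneg[OF T(1), of m q] by simp
  qed
  then have bound: "ell T m q * action m x y \<le> ell T m x * ell K m (\<lambda>j. - y j)" for x y
    by (rule minimizing_action_bound[OF K T(1) min w])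
  have dim: "aff_dim (q ` {..<m}) = int m - 1"
    using vertex_relation_trivial[OF edge_relation_constant[OF K T(1) w qne pne bound]]
    by (rule aff_dim_vertices)
  define W where "W = affine hull (q ` {..<m})"
  have W: "affine W" "q ` {..<m} \<subseteq> W" "W \<subseteq> V"
    using assms(8,9) hull_subset[of "q ` {..<m}" affine] hull_minimal[of "q ` {..<m}" V affine]
    by (auto simp: W_def)
  then have "q ` {..<m} \<subseteq> K \<inter> W" "K \<inter> W \<subseteq> K \<inter> V" using assms(9) by auto
  with W(1) have KW: "K \<inter> W = K \<inter> V" using assms(10)[rule_format, of W] by simp
  have q01: "q 0 \<in> K \<inter> W" "q 1 \<in> K \<inter> W" "q 0 \<noteq> q 1"
    using m qne[of 0] assms(9) W(2) by auto
  \<comment> \<open>Minimality compares only the sections \<open>K \<inter> W\<close> and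
    \<open>K \<inter> V\<close>. By strict convexity the midpoint \<open>z\<close> is interior to
    \<open>K\<close>, so each affine subspace is the affine hull of its section, and equal sections
    give \<open>V = W\<close>.\<close>
  define z where "z = (1/2) *\<^sub>R q 0 + (1/2) *\<^sub>R q 1"
  have "z \<in> open_segment (q 0) (q 1)"
    using q01(3) unfolding z_def in_segment by (intro conjI exI[of _ "1/2"]) auto
  then have "z \<in> interior K" using K(2) q01 unfolding strictly_convex_def by blast
  moreover have "z \<in> W" using mem_affine[OF W(1), of "q 0" "q 1" "1/2" "1/2"] q01 by (simp add: z_def)
  ultimately have "W \<inter> interior K \<noteq> {}" "V \<inter> interior K \<noteq> {}" using W(3) by auto
  then have "affine hull (W \<inter> K) = W" "affine hull (V \<inter> K) = V"
    using affine_hull_affine_Int_nonempty_interior[OF W(1)]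
      affine_hull_affine_Int_nonempty_interior[OF assms(8)] W(1) assms(8)
    by (metis affine_hull_eq)+
  then have "V = W" using KW by (metis Int_commute)
  then show ?thesis using dim by (simp add: W_def aff_dim_affine_hull aff_dim_convex_hull)
qed

end
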